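(* Let $d\ge 1$ be an integer, let $a>0$, let $\rho$ be a probability density on $[0,1]$, and let $x\in\mathbb{R}$. Put $X=(x,\dots,x)\in\mathbb{R}^d$. For $T>0$ let $t\in[0,T]$ be a random variable distributed according to the probability density $\frac{1}{T}\rho(\frac{\cdot}{T})$ on $[0,T]$. Then, as $T\to\infty$, the random variable $$\frac{\mathcal{R}(t\,\mathcal{C}(a)+X,\mathbb{Z}^d)}{t^{d-1}}$$ converges in law. Furthermore, the limit law has characteristic function $$\varphi(u)=\frac{\sin(d2^{d-1}uy)+\sin(d2^{d-1}u(1-y))}{d2^{d-1}u},$$ where $y=|t_{2,0}-t_{1,0}|$, with $t_{2,0}$ the first $t\ge 0$ such that $-t+x\in\mathbb{Z}$ and $t_{1,0}$ the first $t\ge 0$ such that $t+x\in\mathbb{Z}$. In fact, $y=|1-2\{x\}|$, where $\{x\}$ is the fractional part of $x$.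
   Context: For $a>0$, $\mathcal{C}(a)=\{(x_1,\dots,x_d)\in\mathbb{R}^d : |x_i|\le a \text{ for all } i\in\{1,\dots,d\}\}$. For a measurable set $P\subset\mathbb{R}^d$ of finite non-zero Lebesgue measure, $t>0$ and $X\in\mathbb{R}^d$, the set $tP+X$ is $P$ dilated by the factor $t$ relative to $0$ and then translated by $X$; $N(tP+X,\mathbb{Z}^d)=|(tP+X)\cap\mathbb{Z}^d|$ is the number of integer points in it, and the error term is $\mathcal{R}(tP+X,\mathbb{Z}^d)=N(tP+X,\mathbb{Z}^d)-t^d\,\mathrm{Vol}(P)$. The quotient defining $\varphi(u)$ is extended by continuity at $u=0$ (value $1$).
   Formalization: In φ the factor d2^{d-1} is replaced by d2^{d-1}a^{d-1} (the printed one fails for d≥2, a≠1), and y=|1-2{x}| is claimed only for non-integer x (for integer x, y=0 but |1-2{x}|=1); φ is shown to be the same with either value for every x. *)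

theory Defs
  imports "HOL-Probability.Probability"
begin

definition cube :: "real \<Rightarrow> (real ^ 'n) set" where
  "cube a = {v. \<forall>i. \<bar>v $ i\<bar> \<le> a}"

definition dilate_translate :: "real \<Rightarrow> (real ^ 'n) set \<Rightarrow> real ^ 'n \<Rightarrow> (real ^ 'n) set" where
  "dilate_translate t P X = (\<lambda>v. t *\<^sub>R v + X) ` P"

definition int_lattice :: "(real ^ 'n) set" where
  "int_lattice = {v. \<forall>i. v $ i \<in> \<int>}"

(* card of an infinite set is 0; this is a genuine count for bounded P. *)
definition num_points :: "real \<Rightarrow> (real ^ 'n) set \<Rightarrow> real ^ 'n \<Rightarrow> nat" where
  "num_points t P X = card (dilate_translate t P X \<inter> int_lattice)"

definition error_term :: "real \<Rightarrow> (real ^ 'n) set \<Rightarrow> real ^ 'n \<Rightarrow> real" where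
  "error_term t P X = real (num_points t P X) - t ^ CARD('n) * measure lebesgue P"

definition t1 :: "real \<Rightarrow> real" where
  "t1 x = (LEAST t. t \<ge> 0 \<and> t + x \<in> \<int>)"

definition t2 :: "real \<Rightarrow> real" where
  "t2 x = (LEAST t. t \<ge> 0 \<and> - t + x \<in> \<int>)"

definition y_param :: "real \<Rightarrow> real" where
  "y_param x = \<bar>t2 x - t1 x\<bar>"

(* The coefficient of u is the factor in ((2at + e)^d - (2at)^d) / t^(d-1) ~ d (2a)^(d-1) e,
   where e is the error term of an interval of length 2at.
   The value at u = 0 is the limit of the quotient. *)
definition limit_cf :: "nat \<Rightarrow> real \<Rightarrow> real \<Rightarrow> real \<Rightarrow> real" where
  "limit_cf d a y u =
    (let c = real d * 2 ^ (d - 1) * a ^ (d - 1)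
     in if u = 0 then 1 else (sin (c * u * y) + sin (c * u * (1 - y))) / (c * u))"

(* weak_conv_m of the library is indexed by nat; this is its version for a real
   parameter tending to infinity. *)
definition weak_conv_m_at_top :: "(real \<Rightarrow> real measure) \<Rightarrow> real measure \<Rightarrow> bool" where
  "weak_conv_m_at_top Ms L \<longleftrightarrow>
     (\<forall>z. isCont (cdf L) z \<longrightarrow> ((\<lambda>T. cdf (Ms T) z) \<longlongrightarrow> cdf L z) at_top)"

lemma weak_conv_m_at_top_iff_sequences:
  "weak_conv_m_at_top Ms L \<longleftrightarrow>
     (\<forall>\<tau>. filterlim \<tau> at_top sequentially \<longrightarrow> weak_conv_m (\<lambda>n. Ms (\<tau> n)) L)"
proof
  assume *: "weak_conv_m_at_top Ms L"
  show "\<forall>\<tau>. filterlim \<tau> at_top sequentially \<longrightarrow> weak_conv_m (\<lambda>n. Ms (\<tau> n)) L"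
    using * unfolding weak_conv_m_at_top_def weak_conv_m_def weak_conv_def
    by (auto intro: filterlim_compose)
next
  assume *: "\<forall>\<tau>. filterlim \<tau> at_top sequentially \<longrightarrow> weak_conv_m (\<lambda>n. Ms (\<tau> n)) L"
  show "weak_conv_m_at_top Ms L"
    unfolding weak_conv_m_at_top_def
  proof (intro allI impI)
    fix z assume "isCont (cdf L) z"
    then show "((\<lambda>T. cdf (Ms T) z) \<longlongrightarrow> cdf L z) at_top"
      using * unfolding weak_conv_m_def weak_conv_def
      by (intro tendsto_at_topI_sequentially) auto
  qed
qed

end

theory Submission
  imports Defs
begin

text \<open>
  The dilated cube contains \<open>(2 * a * t + e) ^ d\<close> integer points, where \<open>e\<close> is the discrepancy of
  the interval \<open>{x - a * t..x + a * t}\<close>, so the normalised error is \<open>d * (2 * a) ^ (d - 1) * e\<close> up to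
  \<open>O(1 / t)\<close>. As a function of \<open>a * t\<close>, \<open>e\<close> has period one, and Fejer's lemma shows that it
  equidistributes over a period whatever the density \<open>\<rho>\<close> is. Levy's continuity theorem turns the
  convergence of characteristic functions into convergence in law.
\<close>

subsection \<open>Fejer's lemma\<close>

text \<open>The density \<rho> is merely integrable, so equidistribution of the periodic term cannot
  rest on its smoothness. Removing the mean of a bounded periodic function makes its primitive
  bounded, which settles indicators of intervals at rate \<open>1 / T\<close>; every other
  integrable weight is reached by approximation in L1, with errors uniform in \<open>T\<close> but
  without a rate. Half-open intervals are used because they concatenate without overlap, are stable
  under intersection and generate the Borel sets. The centre has equal coordinates, so every
  coordinate admits the same integers and the count is a pure power. The candidate limit is realised
  concretely, as the law of a multiple of the discrepancy at a uniform point of one period. Its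
  characteristic function sees \<open>y\<close> only through the unordered pair of \<open>y\<close>
  and \<open>1 - y\<close>, which is the pair of \<open>frac (2 * x)\<close> and
  \<open>1 - frac (2 * x)\<close>. This symmetry also settles integer \<open>x\<close>, where the
  first hitting times give \<open>y = 0\<close> but \<open>\<bar>1 - 2 * frac x\<bar>\<close> is
  1.\<close>

lemma set_integral_Ioc_translate:
  fixes h :: "real \<Rightarrow> 'b::{banach, second_countable_topology}"
  shows "(LINT w:{\<alpha> + c<..\<beta> + c}|lborel. h w) = (LINT w:{\<alpha><..\<beta>}|lborel. h (w + c))"
  unfolding set_lebesgue_integral_def
  by (subst lborel_integral_real_affine[where c=1 and t=c])
     (auto intro!: Bochner_Integration.integral_cong simp: indicator_def add.commute)

context
  fixes h :: "real \<Rightarrow> 'b::{banach, second_countable_topology}" and B :: real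
  assumes h_measurable[measurable]: "h \<in> borel_measurable borel"
    and h_bound: "\<And>w. norm (h w) \<le> B"
    and h_periodic: "\<And>w. h (w + 1) = h w"
begin

lemma periodic_add_of_int: "h (w + of_int n) = h w"
proof (induction n rule: int_induct[where k=0])
  case (step1 i)
  then show ?case using h_periodic[of "w + of_int i"] by (simp add: algebra_simps)
next
  case (step2 i)
  then show ?case using h_periodic[of "w + of_int i - 1"] by (simp add: algebra_simps)
qed simp

lemma set_integrable_Ioc_bounded: "set_integrable lborel {\<alpha><..\<beta>} h"
proof (cases "\<alpha> \<le> \<beta>")
  case True
  then show ?thesis
    unfolding set_integrable_def
    by (intro integrableI_bounded_set[where A="{\<alpha><..\<beta>}" and B=B])
       (auto simp: h_bound)
qed (simp add: set_integrable_def)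

lemma norm_set_integral_Ioc_le:
  assumes "\<alpha> \<le> \<beta>"
  shows "norm (LINT w:{\<alpha><..\<beta>}|lborel. h w) \<le> B * (\<beta> - \<alpha>)"
proof -
  have "norm (LINT w:{\<alpha><..\<beta>}|lborel. h w) \<le> (\<integral>w. B * indicator {\<alpha><..\<beta>} w \<partial>lborel)"
    unfolding set_lebesgue_integral_def
    using assms set_integrable_Ioc_bounded[unfolded set_integrable_def, of \<alpha> \<beta>]
    by (intro Bochner_Integration.integral_norm_bound_integral integrable_mult_right
          integrable_real_indicator)
       (auto simp: indicator_def h_bound)
  then show ?thesis using assms by simp
qed

lemma set_integral_Ioc_split:
  assumes "\<alpha> \<le> \<beta>" "\<beta> \<le> \<gamma>"
  shows "(LINT w:{\<alpha><..\<gamma>}|lborel. h w) =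
    (LINT w:{\<alpha><..\<beta>}|lborel. h w) + (LINT w:{\<beta><..\<gamma>}|lborel. h w)"
proof -
  have "{\<alpha><..\<gamma>} = {\<alpha><..\<beta>} \<union> {\<beta><..\<gamma>}" using assms by auto
  then show ?thesis
    using set_integral_Un[OF _ set_integrable_Ioc_bounded set_integrable_Ioc_bounded, of \<alpha> \<beta> \<beta> \<gamma>]
    by auto
qed

text \<open>An integer shift brings the left end to \<open>r\<close> in the unit interval; the part
  of the window beyond 1 then moves back by one period and fills the gap between 0 and
  \<open>r\<close>.\<close>

lemma set_integral_period:
  "(LINT w:{\<alpha><..\<alpha> + 1}|lborel. h w) = (LINT w:{0<..1}|lborel. h w)"
proof -
  define r where "r = frac \<alpha>"
  have r: "0 \<le> r" "r \<le> 1" "\<alpha> = r + of_int \<lfloor>\<alpha>\<rfloor>"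
    unfolding r_def using frac_lt_1[of \<alpha>] by (auto simp: frac_def)
  have "(LINT w:{\<alpha><..\<alpha> + 1}|lborel. h w) = (LINT w:{r<..r + 1}|lborel. h w)"
    using set_integral_Ioc_translate[of r "of_int \<lfloor>\<alpha>\<rfloor>" "r + 1" h] r(3)
    by (simp add: periodic_add_of_int algebra_simps)
  also have "\<dots> = (LINT w:{r<..1}|lborel. h w) + (LINT w:{0<..r}|lborel. h w)"
    using r set_integral_Ioc_split[of r 1 "r + 1"]
      set_integral_Ioc_translate[of 0 1 r h] by (simp add: h_periodic)
  also have "\<dots> = (LINT w:{0<..1}|lborel. h w)"
    using r set_integral_Ioc_split[of 0 r 1] by simp
  finally show ?thesis .
qed

lemma integrable_scaleR_dilate:
  assumes f: "integrable lborel (f :: real \<Rightarrow> real)"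
  shows "integrable lborel (\<lambda>s. f s *\<^sub>R h (T * s))"
  using integrable_norm[OF f, THEN integrable_mult_right[of B]] borel_measurable_integrable[OF f]
  by (elim Bochner_Integration.integrable_bound)
     (auto simp: abs_mult mult.commute[of B] intro!: AE_I2 mult_left_mono h_bound[THEN order_trans])

context
  assumes h_mean: "(LINT w:{0<..1}|lborel. h w) = 0"
begin

text \<open>Whole periods contribute nothing, so only a remainder of length at most 1 counts. The
  point is that the bound does not grow with the length of the interval.\<close>

lemma norm_set_integral_mean_zero_le:
  assumes "\<alpha> \<le> \<beta>"
  shows "norm (LINT w:{\<alpha><..\<beta>}|lborel. h w) \<le> B"
proof -
  have B: "B \<ge> 0" using h_bound[of 0] norm_ge_zero order_trans by blast
  have *: "(LINT w:{\<alpha><..\<alpha> + real n}|lborel. h w) = 0" for n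
  proof (induction n)
    case (Suc n)
    then show ?case
      using set_integral_Ioc_split[of \<alpha> "\<alpha> + real n" "\<alpha> + real n + 1"]
        set_integral_period[of "\<alpha> + real n"] h_mean by (simp add: algebra_simps)
  qed (simp add: set_lebesgue_integral_def)
  define n where "n = nat \<lfloor>\<beta> - \<alpha>\<rfloor>"
  have n: "\<alpha> + real n \<le> \<beta>" "\<beta> - (\<alpha> + real n) \<le> 1"
    unfolding n_def using assms by linarith+
  have "(LINT w:{\<alpha><..\<beta>}|lborel. h w) = (LINT w:{\<alpha> + real n<..\<beta>}|lborel. h w)"
    using set_integral_Ioc_split[of \<alpha> "\<alpha> + real n" \<beta>] n * by simp
  also have "norm \<dots> \<le> B * (\<beta> - (\<alpha> + real n))"
    using norm_set_integral_Ioc_le n by simp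
  also have "\<dots> \<le> B" using n B by (intro mult_left_le) auto
  finally show ?thesis .
qed

text \<open>Substituting \<open>w = T * s\<close> gives \<open>1 / T\<close> times an integral over
  a long interval, and the latter stays bounded by \<open>B\<close>.\<close>

lemma oscillating_integral_Ioc:
  "((\<lambda>T. \<integral>s. indicator {\<alpha><..\<beta>} s *\<^sub>R h (T * s) \<partial>lborel) \<longlongrightarrow> 0) at_top"
proof (rule Lim_null_comparison)
  have B: "B \<ge> 0" using h_bound[of 0] norm_ge_zero order_trans by blast
  show "\<forall>\<^sub>F T in at_top. norm (\<integral>s. indicator {\<alpha><..\<beta>} s *\<^sub>R h (T * s) \<partial>lborel) \<le> B / T"
    using eventually_gt_at_top[of 0]
  proof eventually_elim
    case (elim T)
    have "(LINT w:{T * \<alpha><..T * \<beta>}|lborel. h w) = T *\<^sub>R (\<integral>s. indicator {\<alpha><..\<beta>} s *\<^sub>R h (T * s) \<partial>lborel)"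
      unfolding set_lebesgue_integral_def using elim
      by (subst lborel_integral_real_affine[where c=T and t=0])
         (auto intro!: Bochner_Integration.integral_cong simp: indicator_def)
    moreover have "norm (LINT w:{T * \<alpha><..T * \<beta>}|lborel. h w) \<le> B"
    proof (cases "\<alpha> \<le> \<beta>")
      case True
      then show ?thesis using elim by (intro norm_set_integral_mean_zero_le) auto
    next
      case False
      then have "{T * \<alpha><..T * \<beta>} = {}" using elim by auto
      then show ?thesis using B by (simp add: set_lebesgue_integral_def)
    qed
    ultimately show ?case using elim by (simp add: field_simps)
  qed
  show "((\<lambda>T. B / T) \<longlongrightarrow> 0) at_top"
    by (rule real_tendsto_divide_at_top[OF tendsto_const filterlim_ident])
qed

text \<open>Replacing \<open>f\<close> by \<open>s n\<close> costs at most \<open>B\<close> times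
  their L1 distance, whatever \<open>T\<close> is, so \<open>n\<close> can be fixed before
  \<open>T\<close> tends to infinity. This closure property carries the result through disjoint
  unions, exhaustion by bounded sets and approximation by simple functions.\<close>

lemma oscillating_integral_dominated_limit:
  fixes f w :: "real \<Rightarrow> real" and s :: "nat \<Rightarrow> real \<Rightarrow> real"
  assumes s: "\<And>n. integrable lborel (s n)"
    and s_osc: "\<And>n. ((\<lambda>T. \<integral>r. s n r *\<^sub>R h (T * r) \<partial>lborel) \<longlongrightarrow> 0) at_top"
    and f: "integrable lborel f"
    and s_lim: "\<And>r. (\<lambda>n. s n r) \<longlonglongrightarrow> f r"
    and w: "integrable lborel w" "\<And>n r. \<bar>s n r\<bar> \<le> w r"
  shows "((\<lambda>T. \<integral>r. f r *\<^sub>R h (T * r) \<partial>lborel) \<longlongrightarrow> 0) at_top"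
proof (rule tendstoI)
  fix e :: real assume e: "e > 0"
  have B: "B \<ge> 0" using h_bound[of 0] norm_ge_zero order_trans by blast
  have "(\<lambda>n. \<integral>r. \<bar>f r - s n r\<bar> \<partial>lborel) \<longlonglongrightarrow> (\<integral>r. 0 \<partial>(lborel::real measure))"
  proof (rule integral_dominated_convergence[where w="\<lambda>r. \<bar>f r\<bar> + w r"])
    show "AE r in lborel. (\<lambda>n. \<bar>f r - s n r\<bar>) \<longlonglongrightarrow> 0"
      by (intro AE_I2 tendsto_rabs_zero) (auto intro!: tendsto_eq_intros s_lim)
    show "AE r in lborel. norm \<bar>f r - s n r\<bar> \<le> \<bar>f r\<bar> + w r" for n
    proof (rule AE_I2)
      fix r show "norm \<bar>f r - s n r\<bar> \<le> \<bar>f r\<bar> + w r" using w(2)[of n r] by simp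
    qed
  qed (use f s w in auto)
  then have "(\<lambda>n. B * (\<integral>r. \<bar>f r - s n r\<bar> \<partial>lborel)) \<longlonglongrightarrow> 0"
    by (auto intro!: tendsto_eq_intros)
  then have "\<forall>\<^sub>F n in sequentially. B * (\<integral>r. \<bar>f r - s n r\<bar> \<partial>lborel) < e / 2"
    using e by (intro order_tendstoD) auto
  then obtain n where n: "B * (\<integral>r. \<bar>f r - s n r\<bar> \<partial>lborel) < e / 2"
    by (auto simp: eventually_sequentially)
  have "\<forall>\<^sub>F T in at_top. norm (\<integral>r. s n r *\<^sub>R h (T * r) \<partial>lborel) < e / 2"
    using tendstoD[OF s_osc, of "e / 2" n] e by simp
  then show "\<forall>\<^sub>F T in at_top. dist (\<integral>r. f r *\<^sub>R h (T * r) \<partial>lborel) 0 < e"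
  proof eventually_elim
    case (elim T)
    have "(\<integral>r. f r *\<^sub>R h (T * r) \<partial>lborel) - (\<integral>r. s n r *\<^sub>R h (T * r) \<partial>lborel)
        = (\<integral>r. (f r - s n r) *\<^sub>R h (T * r) \<partial>lborel)"
      using f s by (subst Bochner_Integration.integral_diff[symmetric])
        (auto intro!: integrable_scaleR_dilate simp: scaleR_diff_left)
    also have "norm \<dots> \<le> (\<integral>r. B * \<bar>f r - s n r\<bar> \<partial>lborel)"
      using f s B by (intro Bochner_Integration.integral_norm_bound_integral integrable_scaleR_dilate)
        (auto simp: mult.commute[of B] intro!: mult_left_mono h_bound)
    finally show ?case using n elim
      by (simp) (smt (verit) norm_triangle_sub field_sum_of_halves)
  qed
qed

text \<open>A Dynkin class argument started from half-open intervals. The window between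
  \<open>-R\<close> and \<open>R\<close> keeps all measures finite, so that complements can be
  handled by subtraction.\<close>

lemma oscillating_integral_indicator:
  assumes E: "E \<in> sets borel"
  shows "((\<lambda>T. \<integral>s. indicator (E \<inter> {-R<..R}) s *\<^sub>R h (T * s) \<partial>lborel) \<longlongrightarrow> 0) at_top"
proof -
  let ?G = "range (\<lambda>(a, b). {a<..b::real})"
  have sets_eq: "sets borel = sigma_sets UNIV ?G"
    by (subst borel_sigma_sets_Ioc) simp
  have finite_Ioc: "emeasure lborel {-R<..R} < \<infinity>"
    by (cases "-R \<le> R") auto
  have int: "integrable lborel (indicator (A \<inter> {-R<..R}) :: real \<Rightarrow> real)"
    if "A \<in> sets borel" for A
  proof (rule integrable_real_indicator)
    show "emeasure lborel (A \<inter> {-R<..R}) < \<infinity>"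
      using emeasure_mono[of "A \<inter> {-R<..R}" "{-R<..R}" lborel] finite_Ioc
      by (auto intro: le_less_trans)
  qed (use that in auto)
  have "{a<..b} \<inter> {c<..d} \<in> ?G" for a b c d :: real
    by (rule range_eqI[where x="(max a c, min b d)"]) auto
  then have "Int_stable ?G"
    by (auto simp: Int_stable_def)
  then show ?thesis
    using Pow_UNIV[THEN equalityD2, THEN order_trans[OF subset_UNIV]] E[unfolded sets_eq]
  proof (induction rule: sigma_sets_induct_disjoint)
    case (basic A)
    then obtain a b where "A = {a<..b}" by auto
    then have "A \<inter> {-R<..R} = {max a (-R)<..min b R}" by auto
    then show ?case by (simp add: oscillating_integral_Ioc)
  next
    case empty then show ?case by simp
  next
    case (compl A)
    have A: "A \<in> sets borel" using compl sets_eq by simp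
    have eq: "(\<integral>s. indicator ((UNIV - A) \<inter> {-R<..R}) s *\<^sub>R h (T * s) \<partial>lborel)
       = (\<integral>s. indicator {-R<..R} s *\<^sub>R h (T * s) \<partial>lborel)
         - (\<integral>s. indicator (A \<inter> {-R<..R}) s *\<^sub>R h (T * s) \<partial>lborel)" for T
      using int[OF A] int[of UNIV]
      by (subst Bochner_Integration.integral_diff[symmetric])
         (auto intro!: integrable_scaleR_dilate Bochner_Integration.integral_cong
           split: split_indicator)
    show ?case
      unfolding eq using tendsto_diff[OF oscillating_integral_Ioc compl(2)] by simp
  next
    case (union A)
    have A: "A i \<in> sets borel" for i using union(2) sets_eq by auto
    let ?s = "\<lambda>n r. \<Sum>i<n. indicator (A i \<inter> {-R<..R}) r :: real"
    \<comment> \<open>Disjointness gives two readings of the partial sum: as a sum it yields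
      oscillation by linearity, as an indicator it is dominated by the window and converges to the
      full union.\<close>
    have s: "?s n r = indicator ((\<Union>i<n. A i) \<inter> {-R<..R}) r" for n r
    proof -
      have "disjoint_family_on (\<lambda>i. A i \<inter> {-R<..R}) {..<n}"
        using union(1) by (auto simp: disjoint_family_on_def)
      then have "?s n r = indicator (\<Union>i<n. A i \<inter> {-R<..R}) r"
        by (subst indicator_UN_disjoint) auto
      also have "(\<Union>i<n. A i \<inter> {-R<..R}) = (\<Union>i<n. A i) \<inter> {-R<..R}" by auto
      finally show ?thesis .
    qed
    show ?case
    proof (rule oscillating_integral_dominated_limit[where s="?s" and w="indicator (UNIV \<inter> {-R<..R})"])
      show "integrable lborel (?s n)" for n
        using int[OF A] by auto
      show "((\<lambda>T. \<integral>r. ?s n r *\<^sub>R h (T * r) \<partial>lborel) \<longlongrightarrow> 0) at_top" for n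
      proof -
        have eq: "(\<integral>r. ?s n r *\<^sub>R h (T * r) \<partial>lborel)
           = (\<Sum>i<n. \<integral>r. indicator (A i \<inter> {-R<..R}) r *\<^sub>R h (T * r) \<partial>lborel)" for T
          unfolding scaleR_sum_left
          using int[OF A] by (intro Bochner_Integration.integral_sum integrable_scaleR_dilate)
        show ?thesis unfolding eq using tendsto_sum[OF union(3), of "\<lambda>i. i" "{..<n}"] by simp
      qed
      show "(\<lambda>n. ?s n r) \<longlonglongrightarrow> indicator ((\<Union>i. A i) \<inter> {-R<..R}) r" for r
      proof -
        have "(\<Union>i<n. A i \<inter> {-R<..R}) = (\<Union>i<n. A i) \<inter> {-R<..R}"
          "(\<Union>i. A i \<inter> {-R<..R}) = (\<Union>i. A i) \<inter> {-R<..R}" for n by auto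
        then show ?thesis
          unfolding s using LIMSEQ_indicator_UN[of "\<lambda>i. A i \<inter> {-R<..R}" r] by simp
      qed
      show "\<bar>?s n r\<bar> \<le> indicator (UNIV \<inter> {-R<..R}) r" for n r
        unfolding s by (simp add: indicator_def)
      show "integrable lborel (indicator ((\<Union>i. A i) \<inter> {-R<..R}) :: real \<Rightarrow> real)"
        "integrable lborel (indicator (UNIV \<inter> {-R<..R}) :: real \<Rightarrow> real)"
        using A int[of UNIV] by (auto intro!: int)
    qed
  qed
qed

text \<open>The Riemann-Lebesgue statement for a general periodic factor of mean zero; the
  exponential is replaced by \<open>h\<close>.\<close>

lemma oscillating_integral_tendsto_0:
  assumes "integrable lborel (f :: real \<Rightarrow> real)"
  shows "((\<lambda>T. \<integral>s. f s *\<^sub>R h (T * s) \<partial>lborel) \<longlongrightarrow> 0) at_top"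
  using assms
proof (induction rule: integrable_induct)
  case (base A c)
  have A: "A \<in> sets borel" using base by simp
  \<comment> \<open>A set of finite measure may be unbounded, so it is exhausted by windows; its own
    indicator dominates the approximations.\<close>
  let ?s = "\<lambda>n r. indicator (A \<inter> {-real n<..real n}) r :: real"
  have ind: "((\<lambda>T. \<integral>s. indicator A s *\<^sub>R h (T * s) \<partial>lborel) \<longlongrightarrow> 0) at_top"
  proof (rule oscillating_integral_dominated_limit[where s="?s" and w="indicator A"])
    show "integrable lborel (?s n)" for n
    proof (rule integrable_real_indicator)
      show "emeasure lborel (A \<inter> {-real n<..real n}) < \<infinity>"
        using emeasure_mono[of "A \<inter> {-real n<..real n}" A lborel] base
        by (auto intro: le_less_trans)
    qed (use base in auto)
    show "((\<lambda>T. \<integral>r. ?s n r *\<^sub>R h (T * r) \<partial>lborel) \<longlongrightarrow> 0) at_top" for n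
      by (rule oscillating_integral_indicator[OF A])
    show "(\<lambda>n. ?s n r) \<longlonglongrightarrow> indicator A r" for r
    proof (rule tendsto_eventually)
      have "?s n r = indicator A r" if "n \<ge> nat (\<lceil>\<bar>r\<bar>\<rceil> + 1)" for n
      proof -
        have "real n > \<bar>r\<bar>" using that by linarith
        then show ?thesis by (auto simp: indicator_def)
      qed
      then show "\<forall>\<^sub>F n in sequentially. ?s n r = indicator A r"
        unfolding eventually_sequentially by blast
    qed
    show "\<bar>?s n r\<bar> \<le> indicator A r" for n r
      by (simp add: indicator_def)
  qed (use base in auto)
  have "(\<integral>s. (indicator A s *\<^sub>R c) *\<^sub>R h (T * s) \<partial>lborel)
      = c *\<^sub>R (\<integral>s. indicator A s *\<^sub>R h (T * s) \<partial>lborel)" for T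
    unfolding Bochner_Integration.integral_scaleR_right[symmetric] by (simp add: mult.commute)
  then show ?case using tendsto_scaleR[OF tendsto_const ind, of c] by simp
next
  case (add f g)
  have "(\<integral>s. (f s + g s) *\<^sub>R h (T * s) \<partial>lborel)
      = (\<integral>s. f s *\<^sub>R h (T * s) \<partial>lborel) + (\<integral>s. g s *\<^sub>R h (T * s) \<partial>lborel)" for T
    using add by (simp add: scaleR_add_left integrable_scaleR_dilate)
  then show ?case using tendsto_add[OF add(3,4)] by simp
next
  case (lim f s)
  show ?case
  proof (rule oscillating_integral_dominated_limit[where s=s and w="\<lambda>r. 2 * \<bar>f r\<bar>"])
    show "(\<lambda>n. s n r) \<longlonglongrightarrow> f r" for r using lim(2)[of r] by simp
    show "\<bar>s n r\<bar> \<le> 2 * \<bar>f r\<bar>" for n r using lim(3)[of r n] by simp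
    show "integrable lborel (\<lambda>r. 2 * \<bar>f r\<bar>)" using lim(4) by simp
  qed (fact lim)+
qed

end

end

text \<open>Subtracting the mean of \<open>h\<close> reduces this to the oscillating case. The free
  starting point \<alpha> of the period is later set to \<open>x\<close>, where the discrepancy
  takes its simplest form.\<close>

lemma periodic_dilation_integral_tendsto:
  fixes h :: "real \<Rightarrow> 'b::{banach, second_countable_topology}" and f :: "real \<Rightarrow> real"
  assumes h[measurable]: "h \<in> borel_measurable borel"
    and h_bound: "\<And>w. norm (h w) \<le> B"
    and h_periodic: "\<And>w. h (w + 1) = h w"
    and f: "integrable lborel f"
  shows "((\<lambda>T. \<integral>s. f s *\<^sub>R h (T * s) \<partial>lborel) \<longlongrightarrow>
    (\<integral>s. f s \<partial>lborel) *\<^sub>R (LINT w:{\<alpha><..\<alpha> + 1}|lborel. h w)) at_top"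
proof -
  define m where "m = (LINT w:{0<..1}|lborel. h w)"
  let ?k = "\<lambda>w. h w - m"
  have "set_integrable lborel {0<..1} h"
    by (rule set_integrable_Ioc_bounded[OF h h_bound h_periodic])
  then have "(LINT w:{0<..1}|lborel. ?k w) = 0"
    by (subst set_integral_diff) (auto simp: m_def set_integrable_def set_lebesgue_integral_def
         intro!: integrable_scaleR_left)
  then have "((\<lambda>T. \<integral>s. f s *\<^sub>R ?k (T * s) \<partial>lborel) \<longlongrightarrow> 0) at_top"
    using f h_bound h_periodic
    by (intro oscillating_integral_tendsto_0[where B="B + norm m"])
       (auto intro: norm_triangle_le_diff)
  moreover have "(\<integral>s. f s *\<^sub>R ?k (T * s) \<partial>lborel)
      = (\<integral>s. f s *\<^sub>R h (T * s) \<partial>lborel) - (\<integral>s. f s \<partial>lborel) *\<^sub>R m" for T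
    using f integrable_scaleR_dilate[OF h h_bound h_periodic f]
    by (simp add: scaleR_diff_right)
  ultimately have "((\<lambda>T. \<integral>s. f s *\<^sub>R h (T * s) \<partial>lborel) \<longlongrightarrow> (\<integral>s. f s \<partial>lborel) *\<^sub>R m) at_top"
    by (simp add: LIM_zero_iff)
  then show ?thesis
    using set_integral_period[OF h h_bound h_periodic, of \<alpha>] by (simp add: m_def)
qed

subsection \<open>Counting lattice points in the cube\<close>

text \<open>All coordinates range independently over one and the same set of integers. Allowing
  every real \<open>t\<close>, with \<open>\<bar>t\<bar>\<close> by symmetry of the cube, makes
  measurability in \<open>t\<close> immediate on the whole line.\<close>

lemma num_points_cube:
  fixes X :: "real ^ 'n"
  assumes a: "a > 0" and X: "X = (\<chi> i. x)"
  shows "num_points t (cube a) X = nat (\<lfloor>x + \<bar>t\<bar> * a\<rfloor> - \<lceil>x - \<bar>t\<bar> * a\<rceil> + 1) ^ CARD('n)"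
proof -
  let ?l = "\<lceil>x - \<bar>t\<bar> * a\<rceil>" and ?u = "\<lfloor>x + \<bar>t\<bar> * a\<rfloor>"
  let ?F = "\<lambda>g. (\<chi> i. real_of_int (g i)) :: real ^ 'n"
  have mem: "v \<in> dilate_translate t (cube a) X \<longleftrightarrow> (\<forall>i. \<bar>v $ i - x\<bar> \<le> \<bar>t\<bar> * a)" for v
  proof
    assume "v \<in> dilate_translate t (cube a) X"
    then obtain w where w: "\<And>i. \<bar>w $ i\<bar> \<le> a" and v: "v = t *\<^sub>R w + X"
      unfolding dilate_translate_def cube_def by blast
    show "\<forall>i. \<bar>v $ i - x\<bar> \<le> \<bar>t\<bar> * a"
      by (simp add: v X abs_mult w mult_left_mono)
  next
    assume *: "\<forall>i. \<bar>v $ i - x\<bar> \<le> \<bar>t\<bar> * a"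
    \<comment> \<open>At \<open>t = 0\<close> the factor \<open>1 / t\<close> is 0, so the witness
      is the origin; the hypothesis then forces \<open>v = X\<close>.\<close>
    have "v = t *\<^sub>R ((1 / t) *\<^sub>R (v - X)) + X"
      using * by (cases "t = 0") (auto simp: X vec_eq_iff)
    moreover have "(1 / t) *\<^sub>R (v - X) \<in> cube a"
      using * a by (cases "t = 0") (auto simp: X cube_def abs_mult field_simps)
    ultimately show "v \<in> dilate_translate t (cube a) X"
      unfolding dilate_translate_def by blast
  qed
  have "bij_betw ?F (UNIV \<rightarrow>\<^sub>E {?l..?u}) (dilate_translate t (cube a) X \<inter> int_lattice)"
  proof (rule bij_betw_imageI)
    show "inj_on ?F (UNIV \<rightarrow>\<^sub>E {?l..?u})"
      by (auto simp: inj_on_def vec_eq_iff)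
    show "?F ` (UNIV \<rightarrow>\<^sub>E {?l..?u}) = dilate_translate t (cube a) X \<inter> int_lattice"
    proof (intro equalityI subsetI)
      fix v assume "v \<in> ?F ` (UNIV \<rightarrow>\<^sub>E {?l..?u})"
      then obtain g where g: "v = ?F g" "\<And>i. ?l \<le> g i" "\<And>i. g i \<le> ?u" by (auto simp: PiE_iff)
      then have "\<bar>v $ i - x\<bar> \<le> \<bar>t\<bar> * a" for i
        using g(2)[of i, unfolded ceiling_le_iff] g(3)[of i, unfolded le_floor_iff]
        by (simp add: g(1))
      then show "v \<in> dilate_translate t (cube a) X \<inter> int_lattice"
        using g by (auto simp: mem int_lattice_def)
    next
      fix v assume v: "v \<in> dilate_translate t (cube a) X \<inter> int_lattice"
      let ?g = "\<lambda>i. \<lfloor>v $ i\<rfloor>"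
      have "v $ i = real_of_int (?g i)" for i
        using v by (auto simp: int_lattice_def)
      moreover have "?l \<le> ?g i \<and> ?g i \<le> ?u" for i
      proof -
        have "\<bar>v $ i - x\<bar> \<le> \<bar>t\<bar> * a" using v by (simp add: mem)
        then have "x - \<bar>t\<bar> * a \<le> of_int (?g i)" "of_int (?g i) \<le> x + \<bar>t\<bar> * a"
          using calculation[of i] by linarith+
        then show ?thesis
          by (rule conjI[OF ceiling_le_iff[THEN iffD2] le_floor_iff[THEN iffD2]])
      qed
      ultimately show "v \<in> ?F ` (UNIV \<rightarrow>\<^sub>E {?l..?u})"
        by (intro image_eqI[where x="?g"]) (auto simp: vec_eq_iff)
    qed
  qed
  then have "num_points t (cube a) X = card ((UNIV :: 'n set) \<rightarrow>\<^sub>E {?l..?u})"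
    unfolding num_points_def by (simp add: bij_betw_same_card)
  then show ?thesis by (simp add: card_funcsetE)
qed

lemma measure_lebesgue_cube:
  assumes "a > 0"
  shows "measure lebesgue (cube a :: (real ^ 'n) set) = (2 * a) ^ CARD('n)"
proof -
  have eq: "(cube a :: (real ^ 'n) set) = cbox (\<chi> i. - a) (\<chi> i. a)"
    by (simp add: cube_def mem_box_cart set_eq_iff abs_le_iff minus_le_iff[of _ a] conj_commute)
  have "(0 :: real ^ 'n) \<in> cbox (\<chi> i. - a) (\<chi> i. a)"
    using assms by (auto simp: mem_box_cart)
  then have "cbox (\<chi> i. - a) (\<chi> i. a) \<noteq> ({} :: (real ^ 'n) set)" by blast
  then show ?thesis unfolding eq by (simp add: content_cbox_cart)
qed

text \<open>The integers between \<open>x - w\<close> and \<open>x + w\<close> number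
  \<open>\<lfloor>w + x\<rfloor> + \<lfloor>w - x\<rfloor> + 1\<close> for \<open>w \<ge> 0\<close>;
  subtracting the length \<open>2 * w\<close> leaves this formula, whose period in \<open>w\<close>
  is visible.\<close>

definition interval_discrepancy :: "real \<Rightarrow> real \<Rightarrow> real" where
  "interval_discrepancy x w = 1 - frac (w + x) - frac (w - x)"

lemma measurable_interval_discrepancy[measurable]:
  "interval_discrepancy x \<in> borel_measurable borel"
  unfolding interval_discrepancy_def frac_def by measurable

lemma abs_interval_discrepancy_le: "\<bar>interval_discrepancy x w\<bar> \<le> 1"
  unfolding interval_discrepancy_def
  using frac_ge_0[of "w + x"] frac_ge_0[of "w - x"] frac_lt_1[of "w + x"] frac_lt_1[of "w - x"]
  by linarith

lemma interval_discrepancy_periodic: "interval_discrepancy x (w + 1) = interval_discrepancy x w"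
  unfolding interval_discrepancy_def
  using frac_1_eq[of "w + x"] frac_1_eq[of "w - x"] by (simp add: algebra_simps)

lemma count_interval:
  assumes "w \<ge> 0"
  shows "real (nat (\<lfloor>x + w\<rfloor> - \<lceil>x - w\<rceil> + 1)) = 2 * w + interval_discrepancy x w"
proof -
  have "\<lceil>x - w\<rceil> = - \<lfloor>w - x\<rfloor>" by (simp add: ceiling_def)
  moreover have "\<lfloor>x + w\<rfloor> - \<lceil>x - w\<rceil> + 1 \<ge> 0"
    using assms by linarith
  ultimately show ?thesis
    by (simp add: interval_discrepancy_def frac_def add.commute)
qed

section \<open>The normalised error term of the cube\<close>

lemma error_term_measurable:
  fixes X :: "real ^ 'n"
  assumes "a > 0" "X = (\<chi> i. x)"
  shows "(\<lambda>t. error_term t (cube a) X) \<in> borel_measurable borel"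
  unfolding error_term_def num_points_cube[OF assms] by measurable

text \<open>Factoring the difference of the \<open>d\<close>-th powers of
  \<open>2 * a + e / t\<close> and \<open>2 * a\<close> extracts \<open>e / t\<close>. Its
  denominator uses up the one power of \<open>t\<close> left after the normalisation.\<close>

lemma error_term_cube:
  fixes X :: "real ^ 'n"
  assumes a: "a > 0" and X: "X = (\<chi> i. x)" and t: "t > 0"
  shows "error_term t (cube a) X / t ^ (CARD('n) - 1) =
    interval_discrepancy x (a * t) *
      (\<Sum>i<CARD('n). (2 * a) ^ (CARD('n) - Suc i) * (2 * a + interval_discrepancy x (a * t) / t) ^ i)"
proof -
  let ?d = "CARD('n)" and ?e = "interval_discrepancy x (a * t)"
  have "error_term t (cube a) X = (2 * a * t + ?e) ^ ?d - (2 * a * t) ^ ?d"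
    unfolding error_term_def num_points_cube[OF a X] measure_lebesgue_cube[OF a]
    using count_interval[of "a * t" x] a t by (simp add: power_mult_distrib mult_ac)
  also have "\<dots> = t ^ ?d * ((2 * a + ?e / t) ^ ?d - (2 * a) ^ ?d)"
  proof -
    have "2 * a * t + ?e = t * (2 * a + ?e / t)" "2 * a * t = t * (2 * a)"
      using t by (simp_all add: distrib_left)
    then show ?thesis by (simp only: power_mult_distrib right_diff_distrib)
  qed
  also have "(2 * a + ?e / t) ^ ?d - (2 * a) ^ ?d =
      ?e / t * (\<Sum>i<?d. (2 * a) ^ (?d - Suc i) * (2 * a + ?e / t) ^ i)"
    by (subst power_diff_sumr2) simp
  also have "t ^ ?d = t * t ^ (?d - 1)"
    by (simp add: power_eq_if)
  finally show ?thesis using t by simp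
qed

text \<open>The difference is the discrepancy, bounded by 1, times the deviation of the
  geometric-type sum from its limit. Each of the \<open>d\<close> summands tends to
  \<open>(2 * a) ^ (d - 1)\<close>, which is the origin of the constant.\<close>

lemma error_term_cube_asymp:
  fixes X :: "real ^ 'n"
  assumes a: "a > 0" and X: "X = (\<chi> i. x)"
  shows "((\<lambda>t. error_term t (cube a) X / t ^ (CARD('n) - 1)
    - real CARD('n) * 2 ^ (CARD('n) - 1) * a ^ (CARD('n) - 1) * interval_discrepancy x (a * t))
    \<longlongrightarrow> 0) at_top"
proof -
  let ?d = "CARD('n)" and ?e = "\<lambda>t. interval_discrepancy x (a * t)"
  let ?c = "real ?d * 2 ^ (?d - 1) * a ^ (?d - 1)"
  let ?S = "\<lambda>t. \<Sum>i<?d. (2 * a) ^ (?d - Suc i) * (2 * a + ?e t / t) ^ i"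
  have "((\<lambda>t. ?e t / t) \<longlongrightarrow> 0) at_top"
  proof (rule Lim_null_comparison)
    show "\<forall>\<^sub>F t in at_top. norm (?e t / t) \<le> 1 / t"
      using eventually_gt_at_top[of 0]
      by eventually_elim (use abs_interval_discrepancy_le in \<open>auto simp: divide_right_mono\<close>)
    show "((\<lambda>t::real. 1 / t) \<longlongrightarrow> 0) at_top"
      by (rule real_tendsto_divide_at_top[OF tendsto_const filterlim_ident])
  qed
  then have "(?S \<longlongrightarrow> (\<Sum>i<?d. (2 * a) ^ (?d - Suc i) * (2 * a + 0) ^ i)) at_top"
    by (intro tendsto_intros)
  also have "(\<Sum>i<?d. (2 * a) ^ (?d - Suc i) * (2 * a + 0) ^ i) = (\<Sum>i<?d. (2 * a) ^ (?d - 1))"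
    by (intro sum.cong refl) (simp only: add_0_right power_add[symmetric], simp)
  also have "\<dots> = ?c" by (simp add: power_mult_distrib)
  finally have "((\<lambda>t. ?S t - ?c) \<longlongrightarrow> 0) at_top" by (simp add: LIM_zero_iff)
  then have lim: "((\<lambda>t. \<bar>?S t - ?c\<bar>) \<longlongrightarrow> 0) at_top" by (rule tendsto_rabs_zero)
  show ?thesis
  proof (rule Lim_null_comparison[OF _ lim])
    show "\<forall>\<^sub>F t in at_top. norm (error_term t (cube a) X / t ^ (?d - 1) - ?c * ?e t) \<le> \<bar>?S t - ?c\<bar>"
      using eventually_gt_at_top[of 0]
    proof eventually_elim
      case (elim t)
      have "error_term t (cube a) X / t ^ (?d - 1) - ?c * ?e t = ?e t * (?S t - ?c)"
        unfolding error_term_cube[OF a X elim] by (simp only: right_diff_distrib mult.commute)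
      also have "norm \<dots> = \<bar>?e t\<bar> * \<bar>?S t - ?c\<bar>" by (simp add: abs_mult)
      also have "\<dots> \<le> \<bar>?S t - ?c\<bar>"
        using abs_interval_discrepancy_le by (intro mult_left_le_one_le) auto
      finally show ?case .
    qed
  qed
qed

section \<open>The parameter \<open>y\<close> in terms of the fractional part\<close>

lemma t1_eq: "t1 x = (if x \<in> \<int> then 0 else 1 - frac x)"
proof (cases "x \<in> \<int>")
  case True
  then show ?thesis unfolding t1_def by (auto intro!: Least_equality)
next
  case False
  show ?thesis
    unfolding t1_def if_not_P[OF False]
  proof (rule Least_equality)
    have "1 - frac x + x = of_int (\<lfloor>x\<rfloor> + 1)" by (simp add: frac_def)
    then show "1 - frac x \<ge> 0 \<and> 1 - frac x + x \<in> \<int>"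
      using frac_lt_1[of x] by (metis Ints_of_int diff_ge_0_iff_ge less_imp_le)
  next
    fix s assume s: "s \<ge> 0 \<and> s + x \<in> \<int>"
    then obtain k where k: "s + x = of_int k" by (auto elim: Ints_cases)
    have "x \<noteq> of_int k" using False by auto
    then have "x < of_int k" using k s by linarith
    then have "k \<ge> \<lfloor>x\<rfloor> + 1" by linarith
    then have "of_int k \<ge> real_of_int \<lfloor>x\<rfloor> + 1" by linarith
    then show "1 - frac x \<le> s" using k by (simp add: frac_def)
  qed
qed

lemma t2_eq: "t2 x = frac x"
  unfolding t2_def
proof (rule Least_equality)
  show "frac x \<ge> 0 \<and> - frac x + x \<in> \<int>" by (simp add: frac_def)
next
  fix s assume s: "s \<ge> 0 \<and> - s + x \<in> \<int>"
  then obtain k where k: "- s + x = of_int k" by (auto elim: Ints_cases)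
  then have "k \<le> \<lfloor>x\<rfloor>" using s by linarith
  then have "of_int k \<le> real_of_int \<lfloor>x\<rfloor>" by linarith
  then show "frac x \<le> s" using k by (simp add: frac_def)
qed

lemma y_param_not_int: "x \<notin> \<int> \<Longrightarrow> y_param x = \<bar>1 - 2 * frac x\<bar>"
  unfolding y_param_def t1_eq t2_eq by simp

text \<open>At an integer the two parameters are 0 and 1; they are exchanged by
  \<open>y \<mapsto> 1 - y\<close>, which only swaps the two sines.\<close>

lemma limit_cf_y_param: "limit_cf d a (y_param x) u = limit_cf d a \<bar>1 - 2 * frac x\<bar> u"
proof (cases "x \<in> \<int>")
  case True
  then have "frac x = 0" by (simp only: frac_eq_0_iff)
  then have "y_param x = 0" "\<bar>1 - 2 * frac x\<bar> = 1"
    using True by (simp_all only: y_param_def t1_eq t2_eq if_True)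
  then show ?thesis by (simp add: limit_cf_def Let_def)
qed (simp add: y_param_not_int)

text \<open>Links \<open>y\<close> to \<open>frac (2 * x)\<close>, the quantity that the integral
  over a period produces. Which alternative holds depends on whether \<open>frac x\<close> has
  reached one half.\<close>

lemma abs_1_minus_2_frac:
  "\<bar>1 - 2 * frac x\<bar> = frac (2 * x) \<or> \<bar>1 - 2 * frac x\<bar> = 1 - frac (2 * x)" for x :: real
proof -
  have eq: "2 * x = 2 * frac x + of_int (2 * \<lfloor>x\<rfloor>)" by (simp add: frac_def)
  have "frac (2 * x) = 2 * frac x" if "frac x < 1/2"
    unfolding frac_unique_iff using that eq frac_ge_0[of x]
    by (metis Ints_of_int add_diff_cancel_left' field_sum_of_halves mult_2 mult_nonneg_nonneg
        zero_le_numeral add_strict_mono)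
  moreover have "frac (2 * x) = 2 * frac x - 1" if "frac x \<ge> 1/2"
    unfolding frac_unique_iff using that frac_lt_1[of x]
    by (auto simp: frac_def)
  ultimately show ?thesis
    by (cases "frac x < 1/2") auto
qed

subsection \<open>The limit law\<close>

text \<open>As \<open>w\<close> runs from 0 to \<open>L\<close>, \<open>L - 2 * w\<close> sweeps the
  interval from \<open>L\<close> to \<open>-L\<close>, so the imaginary part cancels. The factor
  \<open>\<i> / (2 * K)\<close> inverts the inner derivative \<open>-2 * K * \<i>\<close>.\<close>

lemma set_integral_iexp_symmetric:
  assumes "K \<noteq> 0" "L \<ge> 0"
  shows "(CLINT w:{0<..L}|lborel. iexp (K * (L - 2 * w))) = complex_of_real (sin (K * L) / K)"
proof -
  let ?F = "\<lambda>w. \<i> / (2 * K) * iexp (K * (L - 2 * w))"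
  have "(\<integral>w. indicator {0..L} w *\<^sub>R iexp (K * (L - 2 * w)) \<partial>lborel) = ?F L - ?F 0"
  proof (rule integral_FTC_Icc[OF assms(2)])
    fix w
    show "(?F has_vector_derivative iexp (K * (L - 2 * w))) (at w within {0..L})"
    proof -
      have "((\<lambda>w. K * (L - 2 * w)) has_vector_derivative - 2 * K) (at w within {0..L})"
        unfolding has_real_derivative_iff_has_vector_derivative[symmetric]
        by (auto intro!: derivative_eq_intros)
      from has_vector_derivative_mult_right[of _ _ _ "\<i> / (2 * K)",
          OF vector_diff_chain_within[OF this has_vector_derivative_iexp]]
      show ?thesis using assms(1) by (simp add: o_def scaleR_conv_of_real mult.assoc)
    qed
  qed (intro continuous_intros)
  also have "\<dots> = complex_of_real (sin (K * L) / K)"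
    using assms(1) by (simp add: complex_eq_iff Re_exp Im_exp)
  finally have "(\<integral>w. indicator {0..L} w *\<^sub>R iexp (K * (L - 2 * w)) \<partial>lborel)
    = complex_of_real (sin (K * L) / K)" .
  moreover have "(CLINT w:{0<..L}|lborel. iexp (K * (L - 2 * w)))
    = (\<integral>w. indicator {0..L} w *\<^sub>R iexp (K * (L - 2 * w)) \<partial>lborel)"
    unfolding set_lebesgue_integral_def
    by (intro integral_cong_AE AE_I[where N="{0}"]) (auto simp: indicator_def)
  ultimately show ?thesis by simp
qed

text \<open>Over one period starting at \<open>x\<close> the discrepancy is piecewise affine with slope \<open>-2\<close>: it sweeps
  the symmetric intervals of radius \<open>1 - frac (2 * x)\<close> and \<open>frac (2 * x)\<close>.\<close>
lemma set_integral_iexp_interval_discrepancy: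
  assumes K: "K \<noteq> 0"
  shows "(CLINT w:{x<..x + 1}|lborel. iexp (K * interval_discrepancy x w)) =
    complex_of_real ((sin (K * frac (2 * x)) + sin (K * (1 - frac (2 * x)))) / K)"
proof -
  define f where "f = frac (2 * x)"
  let ?h = "\<lambda>w. iexp (K * interval_discrepancy x w)"
  have f: "0 \<le> f" "f < 1" by (auto simp: f_def frac_lt_1)
  \<comment> \<open>After the shift by \<open>x\<close> the two fractional parts are those of
    \<open>w\<close> and \<open>w + 2 * x\<close>; within the period only the second one wraps, at
    \<open>w = 1 - f\<close>.\<close>
  have disc: "interval_discrepancy x (w + x) = (if w < 1 - f then 1 - f - 2 * w else 2 - f - 2 * w)"
    if "0 \<le> w" "w < 1" for w
  proof -
    have "frac w = w" using that by (simp add: frac_eq)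
    moreover have "frac (w + 2 * x) = (if w + f < 1 then w + f else w + f - 1)"
      using that frac_add[of w "2 * x"] calculation by (simp add: f_def)
    ultimately show ?thesis
      unfolding interval_discrepancy_def by (auto simp: algebra_simps)
  qed
  have "(CLINT w:{x<..x + 1}|lborel. ?h w) = (CLINT w:{0<..1}|lborel. ?h (w + x))"
    using set_integral_Ioc_translate[of 0 x 1 ?h] by (simp add: add.commute)
  also have "\<dots> = (CLINT w:{0<..1 - f}|lborel. ?h (w + x)) + (CLINT w:{1 - f<..1}|lborel. ?h (w + x))"
  proof (rule set_integral_Ioc_split[where B=1])
    show "?h (w + 1 + x) = ?h (w + x)" for w
      using interval_discrepancy_periodic[of x "w + x"] by (simp add: add.commute add.left_commute)
  qed (use f in auto)
  also have "(CLINT w:{0<..1 - f}|lborel. ?h (w + x)) = (CLINT w:{0<..1 - f}|lborel. iexp (K * ((1 - f) - 2 * w)))"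
  proof -
    \<comment> \<open>The inequality is strict because the discrepancy has already jumped at
      \<open>w = 1 - f\<close>; this single point is a null set.\<close>
    have "?h (w + x) = iexp (K * ((1 - f) - 2 * w))" if "0 < w" "w < 1 - f" for w
      using disc[of w] that f by simp
    then show ?thesis
      unfolding set_lebesgue_integral_def
      by (intro integral_cong_AE AE_I[where N="{1 - f}"]) (auto simp: indicator_def le_less[of _ "1 - f"])
  qed
  also have "\<dots> = complex_of_real (sin (K * (1 - f)) / K)"
    using K f by (intro set_integral_iexp_symmetric) auto
  also have "(CLINT w:{1 - f<..1}|lborel. ?h (w + x)) = (CLINT w:{0<..f}|lborel. ?h (w + (1 - f) + x))"
    using set_integral_Ioc_translate[of 0 "1 - f" f "\<lambda>w. ?h (w + x)"] by simp
  also have "\<dots> = (CLINT w:{0<..f}|lborel. iexp (K * (f - 2 * w)))"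
  proof -
    have "?h (w + (1 - f) + x) = iexp (K * (f - 2 * w))" if "0 < w" "w < f" for w
    proof -
      have "interval_discrepancy x (w + (1 - f) + x) = f - 2 * w"
        using disc[of "w + (1 - f)"] that f by simp
      then show ?thesis by simp
    qed
    then show ?thesis
      unfolding set_lebesgue_integral_def
      by (intro integral_cong_AE AE_I[where N="{f}"]) (auto simp: indicator_def le_less[of _ f])
  qed
  also have "\<dots> = complex_of_real (sin (K * f) / K)"
    using K f by (intro set_integral_iexp_symmetric) auto
  finally show ?thesis by (simp add: f_def add_divide_distrib)
qed

lemma set_integral_iexp_eq_limit_cf:
  assumes a: "a > 0" and d: "d > 0"
  shows "(CLINT w:{x<..x + 1}|lborel.
      iexp (u * (real d * 2 ^ (d - 1) * a ^ (d - 1) * interval_discrepancy x w))) =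
    complex_of_real (limit_cf d a (y_param x) u)"
proof -
  define c where "c = real d * 2 ^ (d - 1) * a ^ (d - 1)"
  have c: "c > 0" using a d by (simp add: c_def)
  show ?thesis
  proof (cases "u = 0")
    case True
    then show ?thesis by (simp add: limit_cf_def set_lebesgue_integral_def)
  next
    case False
    then have "(CLINT w:{x<..x + 1}|lborel. iexp (u * (c * interval_discrepancy x w))) =
      complex_of_real ((sin (u * c * frac (2 * x)) + sin (u * c * (1 - frac (2 * x)))) / (u * c))"
      using set_integral_iexp_interval_discrepancy[of "u * c" x] c by (simp add: mult.assoc)
    also have "\<dots> = complex_of_real (limit_cf d a (y_param x) u)"
      using abs_1_minus_2_frac[of x] False
      unfolding limit_cf_y_param unfolding limit_cf_def c_def[symmetric] Let_def
      by (auto simp: mult.commute add.commute)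
    finally show ?thesis by (simp add: c_def)
  qed
qed

text \<open>The continuity theorem is applied with an explicit limit distribution. Starting the
  period at \<open>x\<close> makes its characteristic function exactly the integral already
  computed.\<close>

definition limit_law :: "nat \<Rightarrow> real \<Rightarrow> real \<Rightarrow> real measure" where
  "limit_law d a x = distr (uniform_measure lborel {x<..x + 1}) borel
    (\<lambda>w. real d * 2 ^ (d - 1) * a ^ (d - 1) * interval_discrepancy x w)"

lemma real_distribution_limit_law: "real_distribution (limit_law d a x)"
proof -
  interpret prob_space "uniform_measure lborel {x<..x + 1}"
    by (rule prob_space_uniform_measure) auto
  show ?thesis unfolding limit_law_def by (rule real_distribution_distr) simp
qed

lemma char_limit_law:
  assumes "a > 0" "d > 0"
  shows "char (limit_law d a x) u = complex_of_real (limit_cf d a (y_param x) u)"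
proof -
  have "char (limit_law d a x) u = (CLINT w|uniform_measure lborel {x<..x + 1}.
      iexp (u * (real d * 2 ^ (d - 1) * a ^ (d - 1) * interval_discrepancy x w)))"
    unfolding char_def limit_law_def by (subst integral_distr) auto
  also have "\<dots> = (CLINT w:{x<..x + 1}|lborel.
      iexp (u * (real d * 2 ^ (d - 1) * a ^ (d - 1) * interval_discrepancy x w)))"
  proof -
    have "uniform_measure lborel {x<..x + 1} = density lborel (\<lambda>w. ennreal (indicator {x<..x + 1} w))"
      unfolding uniform_measure_def by (intro density_cong) (auto simp: indicator_def)
    then show ?thesis
      unfolding set_lebesgue_integral_def by (simp add: integral_density)
  qed
  finally show ?thesis using set_integral_iexp_eq_limit_cf[OF assms] by simp
qed

section \<open>Convergence in law under random dilation\<close>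

lemma iexp_diff_tendsto_0:
  assumes "((\<lambda>t. f t - g t) \<longlongrightarrow> 0) F"
  shows "((\<lambda>t. iexp (f t) - iexp (g t)) \<longlongrightarrow> 0) F"
proof (rule Lim_null_comparison)
  \<comment> \<open>Factoring out a number of modulus 1 leaves only \<open>f t - g t\<close>, so
    neither function has to converge by itself.\<close>
  have "norm (iexp (f t) - iexp (g t)) = norm (iexp (g t) * (iexp (f t - g t) - 1))" for t
    by (simp add: right_diff_distrib exp_add[symmetric] algebra_simps)
  then show "\<forall>\<^sub>F t in F. norm (iexp (f t) - iexp (g t)) \<le> norm (iexp (f t - g t) - 1)"
    by (simp add: norm_mult)
  have "((\<lambda>t. iexp (f t - g t)) \<longlongrightarrow> iexp 0) F"
    by (rule isCont_tendsto_compose[OF isCont_iexp assms])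
  then show "((\<lambda>t. norm (iexp (f t - g t) - 1)) \<longlongrightarrow> 0) F"
    by (simp add: LIM_zero_iff tendsto_norm_zero)
qed

text \<open>Random dilations: only the values of \<open>Y\<close> at large arguments matter, and there \<open>Y\<close> is
  asymptotically periodic.\<close>
lemma dilated_iexp_integral_tendsto:
  fixes Y g :: "real \<Rightarrow> real"
  assumes p: "integrable lborel p" "\<And>s. s < 0 \<Longrightarrow> p s = 0" "(\<integral>s. p s \<partial>lborel) = 1"
    and Y[measurable]: "Y \<in> borel_measurable borel"
    and g[measurable]: "g \<in> borel_measurable borel"
    and g_periodic: "\<And>w. g (w + 1) = g w"
    and a: "a > 0"
    and asymp: "((\<lambda>t. Y t - g (a * t)) \<longlongrightarrow> 0) at_top"
  shows "((\<lambda>T. CLINT s|lborel. p s *\<^sub>R iexp (u * Y (T * s))) \<longlongrightarrow>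
    (CLINT w:{\<alpha><..\<alpha> + 1}|lborel. iexp (u * g w))) at_top"
proof -
  have [measurable]: "p \<in> borel_measurable borel"
    using borel_measurable_integrable[OF p(1)] by simp
  have int: "integrable lborel (\<lambda>s. p s *\<^sub>R iexp (f s))" if [measurable]: "f \<in> borel_measurable borel" for f
    by (rule Bochner_Integration.integrable_bound[OF p(1)]) auto
  have "((\<lambda>T. CLINT s|lborel. p s *\<^sub>R iexp (u * g (T * s))) \<longlongrightarrow>
      (\<integral>s. p s \<partial>lborel) *\<^sub>R (CLINT w:{\<alpha><..\<alpha> + 1}|lborel. iexp (u * g w))) at_top"
    by (rule periodic_dilation_integral_tendsto[where B=1 and h="\<lambda>w. iexp (u * g w)"])
       (auto simp: g_periodic p(1))
  \<comment> \<open>The periodic variable is \<open>a * t\<close>, so Fejer's lemma is used along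
    \<open>a * T\<close> in place of \<open>T\<close>.\<close>
  moreover have "filterlim (\<lambda>T. a * T) at_top at_top"
    using a by (intro filterlim_tendsto_pos_mult_at_top[OF tendsto_const] filterlim_ident)
  ultimately have main: "((\<lambda>T. CLINT s|lborel. p s *\<^sub>R iexp (u * g (a * T * s))) \<longlongrightarrow>
      (CLINT w:{\<alpha><..\<alpha> + 1}|lborel. iexp (u * g w))) at_top"
    unfolding p(3) scaleR_one by (rule filterlim_compose)
  have diff: "((\<lambda>T. CLINT s|lborel. p s *\<^sub>R (iexp (u * Y (T * s)) - iexp (u * g (a * T * s)))) \<longlongrightarrow>
      (CLINT s|(lborel::real measure). 0)) at_top"
  proof (rule integral_dominated_convergence_at_top[where w="\<lambda>s. 2 * \<bar>p s\<bar>"])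
    show "AE s in lborel. ((\<lambda>T. p s *\<^sub>R (iexp (u * Y (T * s)) - iexp (u * g (a * T * s)))) \<longlongrightarrow> 0) at_top"
    \<comment> \<open>For fixed \<open>s > 0\<close> the argument \<open>T * s\<close> tends to
      infinity; negative \<open>s\<close> carry no mass, and \<open>s = 0\<close> is a null
      set.\<close>
    proof (rule AE_mp[OF AE_lborel_singleton[of 0]], rule AE_I2, rule impI)
      fix s :: real assume "s \<noteq> 0"
      show "((\<lambda>T. p s *\<^sub>R (iexp (u * Y (T * s)) - iexp (u * g (a * T * s)))) \<longlongrightarrow> 0) at_top"
      proof (cases "s > 0")
        case True
        then have "filterlim (\<lambda>T. T * s) at_top at_top"
          by (intro filterlim_at_top_mult_tendsto_pos[OF tendsto_const] filterlim_ident)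
        from filterlim_compose[OF asymp this]
        have "((\<lambda>T. u * (Y (T * s) - g (a * (T * s)))) \<longlongrightarrow> 0) at_top"
          by (rule tendsto_mult_right_zero)
        then have "((\<lambda>T. iexp (u * Y (T * s)) - iexp (u * g (a * T * s))) \<longlongrightarrow> 0) at_top"
          by (intro iexp_diff_tendsto_0) (simp add: right_diff_distrib mult.assoc)
        from tendsto_scaleR[OF tendsto_const this, of "p s"] show ?thesis by simp
      next
        case False
        then have "p s = 0" using \<open>s \<noteq> 0\<close> by (intro p(2)) auto
        then show ?thesis by simp
      qed
    qed
    show "\<forall>\<^sub>F T in at_top. AE s in lborel.
        norm (p s *\<^sub>R (iexp (u * Y (T * s)) - iexp (u * g (a * T * s)))) \<le> 2 * \<bar>p s\<bar>"
    proof (intro always_eventually allI AE_I2)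
      fix T s
      have "norm (iexp (u * Y (T * s)) - iexp (u * g (a * T * s))) \<le> 1 + 1"
        by (rule norm_triangle_le_diff) simp
      then show "norm (p s *\<^sub>R (iexp (u * Y (T * s)) - iexp (u * g (a * T * s)))) \<le> 2 * \<bar>p s\<bar>"
        by (simp add: mult.commute[of 2] mult_left_mono)
    qed
  qed (use p(1) in auto)
  have "(CLINT s|lborel. p s *\<^sub>R (iexp (u * Y (T * s)) - iexp (u * g (a * T * s)))) =
      (CLINT s|lborel. p s *\<^sub>R iexp (u * Y (T * s))) - (CLINT s|lborel. p s *\<^sub>R iexp (u * g (a * T * s)))" for T
    unfolding scaleR_diff_right by (intro Bochner_Integration.integral_diff int) measurable
  then show ?thesis
    using tendsto_add[OF diff main] by simp
qed

text \<open>Levy's theorem is applied along each sequence tending to infinity. Its finitely many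
  terms at which \<open>T\<close> may be nonpositive are skipped by the shift \<open>N\<close>,
  since \<open>Ms T\<close> is assumed to be a distribution only for \<open>T > 0\<close>.\<close>

lemma weak_conv_m_at_topI_char:
  fixes Ms :: "real \<Rightarrow> real measure"
  assumes Ms: "\<And>T. T > 0 \<Longrightarrow> real_distribution (Ms T)" and L: "real_distribution L"
    and char: "\<And>u. ((\<lambda>T. char (Ms T) u) \<longlongrightarrow> char L u) at_top"
  shows "weak_conv_m_at_top Ms L"
  unfolding weak_conv_m_at_top_iff_sequences
proof (intro allI impI)
  fix \<tau> :: "nat \<Rightarrow> real" assume \<tau>: "filterlim \<tau> at_top sequentially"
  then have "\<forall>\<^sub>F n in sequentially. \<tau> n > 0" by (simp add: filterlim_at_top_dense)
  then obtain N where N: "\<And>n. n \<ge> N \<Longrightarrow> \<tau> n > 0" by (auto simp: eventually_sequentially)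
  have "weak_conv_m (\<lambda>n. Ms (\<tau> (n + N))) L"
  proof (rule levy_continuity[OF Ms L])
    show "(\<lambda>n. char (Ms (\<tau> (n + N))) u) \<longlonglongrightarrow> char L u" for u
      using LIMSEQ_ignore_initial_segment[OF filterlim_compose[OF char \<tau>], of N u] .
  qed (simp add: N)
  then show "weak_conv_m (\<lambda>n. Ms (\<tau> n)) L"
    unfolding weak_conv_m_def weak_conv_def by (auto intro: LIMSEQ_offset[where k=N])
qed

text \<open>Convergence in law concerns only the distributions, so each \<open>T\<close> may have
  its own probability space. The last two clauses separate the formula for \<open>y\<close>, which
  holds off the integers, from the equality of characteristic functions, which holds for every
  \<open>x\<close>.\<close>

theorem theorem1:
  fixes a x :: real
    and \<rho> :: "real \<Rightarrow> real"
    and M :: "real \<Rightarrow> 'b measure"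
    and t :: "real \<Rightarrow> 'b \<Rightarrow> real"
    and X :: "real ^ 'n"
  defines "X \<equiv> (\<chi> i. x)"
  assumes a: "a > 0"
    and rho_measurable: "set_borel_measurable borel {0..1} \<rho>"
    and rho_nonneg: "\<And>s. s \<in> {0..1} \<Longrightarrow> \<rho> s \<ge> 0"
    and rho_total: "(\<integral>\<^sup>+ s \<in> {0..1}. ennreal (\<rho> s) \<partial>lborel) = 1"
    and prob: "\<And>T. T > 0 \<Longrightarrow> prob_space (M T)"
    and t_density: "\<And>T. T > 0 \<Longrightarrow>
      distributed (M T) lborel (t T) (\<lambda>s. ennreal (indicator {0..T} s * (1 / T * \<rho> (s / T))))"
  shows "(\<exists>L. real_distribution L \<and>
            weak_conv_m_at_top
              (\<lambda>T. distr (M T) borel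
                (\<lambda>\<omega>. error_term (t T \<omega>) (cube a) X / t T \<omega> ^ (CARD('n) - 1))) L \<and>
            (\<forall>u. char L u = complex_of_real (limit_cf CARD('n) a (y_param x) u))) \<and>
         (x \<notin> \<int> \<longrightarrow> y_param x = \<bar>1 - 2 * frac x\<bar>) \<and>
         (\<forall>u. limit_cf CARD('n) a (y_param x) u = limit_cf CARD('n) a \<bar>1 - 2 * frac x\<bar> u)"
proof -
  let ?d = "CARD('n)"
  define p where "p s = indicator {0..1} s * \<rho> s" for s
  define Y where "Y s = error_term s (cube a) X / s ^ (?d - 1)" for s
  let ?g = "\<lambda>w. real ?d * 2 ^ (?d - 1) * a ^ (?d - 1) * interval_discrepancy x w"
  have X: "X = (\<chi> i. x)" unfolding X_def ..
  have p_measurable[measurable]: "p \<in> borel_measurable borel"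
    using rho_measurable by (simp add: set_borel_measurable_def p_def[abs_def])
  have p_nonneg: "p s \<ge> 0" for s
    by (simp add: p_def indicator_def rho_nonneg)
  have "(\<integral>\<^sup>+ s. ennreal (p s) \<partial>lborel) = (\<integral>\<^sup>+ s \<in> {0..1}. ennreal (\<rho> s) \<partial>lborel)"
    by (intro nn_integral_cong) (auto simp: p_def indicator_def)
  then have p_total: "(\<integral>\<^sup>+ s. ennreal (p s) \<partial>lborel) = ennreal 1"
    using rho_total by simp
  have p_int: "integrable lborel p" "(\<integral>s. p s \<partial>lborel) = 1"
    using integrableI_nn_integral_finite[OF _ _ p_total]
      integral_eq_nn_integral[of p lborel] p_total p_nonneg by auto
  have Y_measurable[measurable]: "Y \<in> borel_measurable borel"
    unfolding Y_def[abs_def] using error_term_measurable[OF a X] by measurable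
  \<comment> \<open>The substitution \<open>s \<mapsto> T * s\<close> absorbs the factor
    \<open>1 / T\<close> of the density and moves \<open>T\<close> into the argument of
    \<open>Y\<close>, leaving the fixed weight \<open>p\<close>, which is \<rho> extended by
    zero.\<close>
  have char_eq: "char (distr (M T) borel (\<lambda>\<omega>. Y (t T \<omega>))) u = (CLINT s|lborel. p s *\<^sub>R iexp (u * Y (T * s)))"
    if T: "T > 0" for T u
  proof -
    have dens: "indicator {0..T} s * (1 / T * \<rho> (s / T)) = p (s / T) / T" for s
      using T by (simp add: p_def indicator_def field_simps)
    note D = t_density[OF T, unfolded dens]
    note [measurable] = distributed_measurable[OF D, simplified]
    have "char (distr (M T) borel (\<lambda>\<omega>. Y (t T \<omega>))) u = (CLINT s|distr (M T) lborel (t T). iexp (u * Y s))"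
      unfolding char_def by (simp add: integral_distr)
    also have "\<dots> = (CLINT s|lborel. (p (s / T) / T) *\<^sub>R iexp (u * Y s))"
      unfolding distributed_distr_eq_density[OF D]
      using T p_nonneg by (intro integral_density) auto
    also have "\<dots> = (CLINT s|lborel. p s *\<^sub>R iexp (u * Y (T * s)))"
      using T by (subst lborel_integral_real_affine[where c=T and t=0]) (simp_all flip: integral_scaleR_right)
    finally show ?thesis .
  qed
  have "weak_conv_m_at_top (\<lambda>T. distr (M T) borel (\<lambda>\<omega>. Y (t T \<omega>))) (limit_law ?d a x)"
  proof (rule weak_conv_m_at_topI_char[OF _ real_distribution_limit_law])
    fix T :: real assume T: "T > 0"
    interpret prob_space "M T" by (rule prob[OF T])
    note [measurable] = distributed_measurable[OF t_density[OF T], simplified]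
    show "real_distribution (distr (M T) borel (\<lambda>\<omega>. Y (t T \<omega>)))"
      by (rule real_distribution_distr) measurable
  next
    fix u
    have "((\<lambda>T. CLINT s|lborel. p s *\<^sub>R iexp (u * Y (T * s))) \<longlongrightarrow>
        (CLINT w:{x<..x + 1}|lborel. iexp (u * ?g w))) at_top"
      using error_term_cube_asymp[OF a X, folded Y_def]
      by (intro dilated_iexp_integral_tendsto[where a=a] p_int a Y_measurable)
         (auto simp: p_def interval_discrepancy_periodic)
    also have "(CLINT w:{x<..x + 1}|lborel. iexp (u * ?g w)) = char (limit_law ?d a x) u"
      using a by (simp only: set_integral_iexp_eq_limit_cf char_limit_law zero_less_card_finite)
    finally show "((\<lambda>T. char (distr (M T) borel (\<lambda>\<omega>. Y (t T \<omega>))) u) \<longlongrightarrow> char (limit_law ?d a x) u) at_top"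
      by (rule Lim_transform_eventually)
         (use eventually_gt_at_top[of 0] in eventually_elim, simp add: char_eq)
  qed
  then show ?thesis
    using real_distribution_limit_law[of ?d a x] char_limit_law[OF a zero_less_card_finite]
      y_param_not_int[of x] limit_cf_y_param[of ?d a x]
    unfolding Y_def by blast
qed

end
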